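(* Let $k\ge 1$, $r\ge 2$ be integers such that $k+1$ and $r-1$ are coprime, let $n\ge 1$, and let $\beta(k,r)=-\frac{r-1}{k+1}$. If $\lambda$ is a $(k,r,n)$-admissible partition, then the Jack polynomial $P_\lambda(x_1,\dots,x_n;\beta)$ has no pole at $\beta=\beta(k,r)$.
   Context: Partitions: $\pi_n$ is the set of partitions $\lambda=(\lambda_1\ge\dots\ge\lambda_n\ge 0)$ of length at most $n$. A partition $\lambda\in\pi_n$ is $(k,r,n)$-admissible if $\lambda_i-\lambda_{i+k}\ge r$ for all $1\le i\le n-k$. Dominance order: for $|\mu|=|\lambda|$, $\mu\le\lambda$ means $\mu_1+\dots+\mu_i\le\lambda_1+\dots+\lambda_i$ for $1\le i\le n$. The orbit sums are $m_\lambda=\sum_{\alpha\in S_n\lambda}x^\alpha$. Jack polynomials: let $K_{ij}$ be the operator exchanging the variables $x_i,x_j$, $\partial_i=\partial/\partial x_i$, $\hat D_i=x_i\partial_i+\beta\sum_{j\neq i}\frac{x_{\max\{i,j\}}}{x_i-x_j}(1-K_{ij})+\beta(n-i)$ ($1\le i\le n$), which are commuting operators, and $S(u,\beta)=\prod_{i=1}^n(u+\hat D_i)$. The Jack polynomials $P_\lambda=P_\lambda(x;\beta)$, $\lambda\in\pi_n$, are the unique $\mathbb{C}(\beta)$-basis of $\mathbb{C}(\beta)[x_1,\dots,x_n]^{S_n}$ ($\beta$ an indeterminate) such that $S(u,\beta)P_\lambda=\prod_{i=1}^n(u+\lambda_i+(n-i)\beta)\,P_\lambda$ and $P_\lambda=m_\lambda+\sum_{\mu<\lambda}u_{\lambda\mu}(\beta)m_\mu$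 with $u_{\lambda\mu}(\beta)\in\mathbb{C}(\beta)$. "$P_\lambda$ has no pole at $\beta_0$" means that none of the coefficients $u_{\lambda\mu}(\beta)$ has a pole at $\beta=\beta_0$. *)

theory Defs
  imports
    "HOL-Library.Poly_Mapping"
    "HOL-Computational_Algebra.Polynomial"
    "HOL-Computational_Algebra.Fraction_Field"
    "HOL-Combinatorics.Permutations"
    Complex_Main
begin

section \<open>Polynomials over the field of rational functions\<close>

text \<open>
  Partitions and, more generally, exponent vectors are finitely supported functions on the
  naturals; the variables are numbered from 1, so an object in \<open>n\<close> variables is one supported
  in \<open>{1..n}\<close>. A polynomial is a finitely supported function from exponent vectors to
  coefficients, and multiplication on this type is the convolution product.
\<close>

type_synonym expo = "nat \<Rightarrow>\<^sub>0 nat"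
type_synonym ratfun = "complex poly fract"
type_synonym mpol = "expo \<Rightarrow>\<^sub>0 ratfun"

definition beta :: ratfun
  where "beta = Fract [:0, 1:] 1"

text \<open>Regularity at \<open>b\<close>: some representation as a fraction has a denominator not vanishing at \<open>b\<close>.\<close>

definition has_pole_at :: "ratfun \<Rightarrow> complex \<Rightarrow> bool"
  where "has_pole_at f b \<longleftrightarrow> \<not> (\<exists>p q. f = Fract p q \<and> poly q b \<noteq> 0)"

definition monom_x :: "expo \<Rightarrow> mpol"
  where "monom_x a = Poly_Mapping.single a 1"

definition X :: "nat \<Rightarrow> mpol"
  where "X i = monom_x (Poly_Mapping.single i 1)"

definition scale :: "ratfun \<Rightarrow> mpol \<Rightarrow> mpol"
  where "scale c f = Poly_Mapping.single 0 c * f"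

interpretation mpol: vector_space scale
proof
  fix a b :: ratfun and x y :: mpol
  show "scale a (x + y) = scale a x + scale a y"
    by (simp add: scale_def distrib_left)
  show "scale (a + b) x = scale a x + scale b x"
    by (simp add: scale_def single_add distrib_right)
  show "scale a (scale b x) = scale (a * b) x"
    unfolding scale_def mult.assoc[symmetric] mult_single by simp
  show "scale 1 x = x"
    by (simp add: scale_def)
qed

definition permute_expo :: "(nat \<Rightarrow> nat) \<Rightarrow> expo \<Rightarrow> expo"
  where "permute_expo \<sigma> a = Poly_Mapping.map_key \<sigma> a"

definition permute_vars :: "(nat \<Rightarrow> nat) \<Rightarrow> mpol \<Rightarrow> mpol"
  where "permute_vars \<sigma> f = Poly_Mapping.map_key (permute_expo \<sigma>) f"

definition symmetric_pols :: "nat \<Rightarrow> mpol set"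
  where "symmetric_pols n =
    {f. (\<forall>a \<in> Poly_Mapping.keys f. Poly_Mapping.keys a \<subseteq> {1..n}) \<and>
        (\<forall>\<sigma>. \<sigma> permutes {1..n} \<longrightarrow> permute_vars \<sigma> f = f)}"


section \<open>The commuting operators\<close>

definition K :: "nat \<Rightarrow> nat \<Rightarrow> mpol \<Rightarrow> mpol"
  where "K i j f = permute_vars (transpose i j) f"

text \<open>In a summand with \<open>lookup a i = 0\<close> the truncated exponent is harmless: its coefficient is 0.\<close>

definition partial :: "nat \<Rightarrow> mpol \<Rightarrow> mpol"
  where "partial i f =
    (\<Sum>a \<in> Poly_Mapping.keys f.
      Poly_Mapping.single (a - Poly_Mapping.single i 1)
        (of_nat (Poly_Mapping.lookup a i) * Poly_Mapping.lookup f a))"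

text \<open>
  The quotient \<open>(f - K i j f) / (X i - X j)\<close>; the division is exact, see \<open>divided_difference\<close> below.
\<close>

definition div_diff :: "nat \<Rightarrow> nat \<Rightarrow> mpol \<Rightarrow> mpol"
  where "div_diff i j f = (THE g. (X i - X j) * g = f - K i j f)"

definition D :: "nat \<Rightarrow> nat \<Rightarrow> mpol \<Rightarrow> mpol"
  where "D n i f =
    X i * partial i f
    + scale beta (\<Sum>j \<in> {1..n} - {i}. X (max i j) * div_diff i j f)
    + scale (beta * of_nat (n - i)) f"

text \<open>
  \<open>S n u\<close> is the composition \<open>(u + D n 1) \<circ> \<dots> \<circ> (u + D n n)\<close>; the factors commute on
  polynomials in \<open>n\<close> variables, so the order does not matter.
\<close>

definition S :: "nat \<Rightarrow> ratfun \<Rightarrow> mpol \<Rightarrow> mpol"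
  where "S n u f = foldr (\<lambda>i g. scale u g + D n i g) [1..<n+1] f"


section \<open>Partitions and Jack polynomials\<close>

definition partitions :: "nat \<Rightarrow> expo set"
  where "partitions n =
    {lam. Poly_Mapping.keys lam \<subseteq> {1..n} \<and>
          (\<forall>i j. 1 \<le> i \<and> i \<le> j \<and> j \<le> n \<longrightarrow> Poly_Mapping.lookup lam j \<le> Poly_Mapping.lookup lam i)}"

definition admissible :: "nat \<Rightarrow> nat \<Rightarrow> nat \<Rightarrow> expo \<Rightarrow> bool"
  where "admissible k r n lam \<longleftrightarrow>
    lam \<in> partitions n \<and>
    (\<forall>i. 1 \<le> i \<and> i + k \<le> n \<longrightarrow>
      int (Poly_Mapping.lookup lam i) - int (Poly_Mapping.lookup lam (i + k)) \<ge> int r)"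

definition dominated :: "nat \<Rightarrow> expo \<Rightarrow> expo \<Rightarrow> bool"
  where "dominated n mu lam \<longleftrightarrow>
    (\<Sum>j = 1..n. Poly_Mapping.lookup mu j) = (\<Sum>j = 1..n. Poly_Mapping.lookup lam j) \<and>
    (\<forall>i \<in> {1..n}. (\<Sum>j = 1..i. Poly_Mapping.lookup mu j) \<le> (\<Sum>j = 1..i. Poly_Mapping.lookup lam j))"

definition strictly_below :: "nat \<Rightarrow> expo \<Rightarrow> expo set"
  where "strictly_below n lam = {mu \<in> partitions n. dominated n mu lam \<and> mu \<noteq> lam}"

definition orbit_sum :: "nat \<Rightarrow> expo \<Rightarrow> mpol"
  where "orbit_sum n lam = (\<Sum>a \<in> {permute_expo \<sigma> lam | \<sigma>. \<sigma> permutes {1..n}}. monom_x a)"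

text \<open>
  The defining properties of the Jack polynomials \<open>P lam\<close>, for \<open>lam\<close> in \<open>partitions n\<close>, together
  with the coefficients \<open>c lam mu\<close> of their expansions in orbit sums. They determine \<open>P lam\<close> and
  \<open>c lam mu\<close> uniquely for \<open>lam\<close> in \<open>partitions n\<close> and \<open>mu\<close> in \<open>strictly_below n lam\<close>; other
  values of \<open>P\<close> and \<open>c\<close> are irrelevant.
\<close>

definition jack_polynomials :: "nat \<Rightarrow> (expo \<Rightarrow> mpol) \<Rightarrow> (expo \<Rightarrow> expo \<Rightarrow> ratfun) \<Rightarrow> bool"
  where "jack_polynomials n P c \<longleftrightarrow>
    inj_on P (partitions n) \<and>
    \<not> mpol.dependent (P ` partitions n) \<and>
    mpol.span (P ` partitions n) = symmetric_pols n \<and>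
    (\<forall>lam \<in> partitions n.
      (\<forall>u. S n u (P lam) =
         scale (\<Prod>i = 1..n. u + of_nat (Poly_Mapping.lookup lam i) + of_nat (n - i) * beta) (P lam)) \<and>
      P lam = orbit_sum n lam + (\<Sum>mu \<in> strictly_below n lam. scale (c lam mu) (orbit_sum n mu)))"


section \<open>Well-definedness\<close>

lemma lookup_permute_expo:
  assumes "inj \<sigma>"
  shows "Poly_Mapping.lookup (permute_expo \<sigma> a) i = Poly_Mapping.lookup a (\<sigma> i)"
  using assms by (simp add: permute_expo_def Poly_Mapping.map_key.rep_eq)

lemma inj_permute_expo:
  assumes "bij \<sigma>"
  shows "inj (permute_expo \<sigma>)"
proof (rule injI)
  fix a b assume eq: "permute_expo \<sigma> a = permute_expo \<sigma> b"
  have "Poly_Mapping.lookup a i = Poly_Mapping.lookup b i" for i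
  proof -
    obtain j where "i = \<sigma> j" using bij_is_surj[OF assms] by (rule surjE)
    then show ?thesis
      using arg_cong[OF eq, of "\<lambda>a. Poly_Mapping.lookup a j"] assms
      by (simp add: lookup_permute_expo bij_is_inj)
  qed
  then show "a = b" by (simp add: poly_mapping_eqI)
qed

lemma lookup_permute_vars:
  assumes "bij \<sigma>"
  shows "Poly_Mapping.lookup (permute_vars \<sigma> f) a = Poly_Mapping.lookup f (permute_expo \<sigma> a)"
  using inj_permute_expo[OF assms] by (simp add: permute_vars_def Poly_Mapping.map_key.rep_eq)

lemma finite_strictly_below: "finite (strictly_below n lam)"
proof (rule finite_subset)
  let ?N = "\<Sum>j = 1..n. Poly_Mapping.lookup lam j"
  let ?F = "{f. \<forall>i. (i \<in> {1..n} \<longrightarrow> f i \<in> {..?N}) \<and> (i \<notin> {1..n} \<longrightarrow> f i = (0::nat))}"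
  show "strictly_below n lam \<subseteq> Poly_Mapping.lookup -` ?F"
  proof
    fix mu assume mu: "mu \<in> strictly_below n lam"
    have "Poly_Mapping.lookup mu i \<le> ?N" if "i \<in> {1..n}" for i
      using member_le_sum[of i "{1..n}" "Poly_Mapping.lookup mu"] that mu
      by (simp add: strictly_below_def dominated_def)
    moreover have "Poly_Mapping.lookup mu i = 0" if "i \<notin> {1..n}" for i
      using mu that unfolding strictly_below_def partitions_def by (auto simp: in_keys_iff)
    ultimately show "mu \<in> Poly_Mapping.lookup -` ?F" by auto
  qed
  show "finite (Poly_Mapping.lookup -` ?F)"
  proof (rule finite_vimageI)
    show "finite ?F" by (rule finite_set_of_finite_funs) simp_all
    show "inj (Poly_Mapping.lookup :: expo \<Rightarrow> nat \<Rightarrow> nat)"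
      by (rule injI) (simp add: poly_mapping_eqI)
  qed
qed

lemma X_diff_dvd: "X i - X j dvd f - K i j f"
proof (induction f rule: update_induct)
  case const
  have "K i j 0 = 0"
    by (intro poly_mapping_eqI) (simp add: K_def lookup_permute_vars)
  then show ?case by simp
next
  case (update f a b)
  let ?s = "transpose i j"
  have upd: "Poly_Mapping.update a b f = f + Poly_Mapping.single a b"
    using update(1) by (intro poly_mapping_eqI)
      (auto simp: lookup_update lookup_add lookup_single when_def in_keys_iff)
  have K_add: "K i j (f + g) = K i j f + K i j g" for f g
    by (intro poly_mapping_eqI) (simp add: K_def lookup_permute_vars lookup_add)
  have inv: "permute_expo ?s (permute_expo ?s a) = a" for a
    by (intro poly_mapping_eqI) (simp add: lookup_permute_expo)
  have K_single: "K i j (Poly_Mapping.single a b) = Poly_Mapping.single (permute_expo ?s a) b"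
  proof (intro poly_mapping_eqI)
    fix e
    have "a = permute_expo ?s e \<longleftrightarrow> permute_expo ?s a = e" using inv by metis
    then show "Poly_Mapping.lookup (K i j (Poly_Mapping.single a b)) e
        = Poly_Mapping.lookup (Poly_Mapping.single (permute_expo ?s a) b) e"
      by (simp add: K_def lookup_permute_vars lookup_single)
  qed
  have "X i - X j dvd Poly_Mapping.single a b - Poly_Mapping.single (permute_expo ?s a) b"
  proof (cases "i = j")
    case True
    then show ?thesis by (simp add: permute_expo_def map_key_id id_def)
  next
    case False
    define p q where "p = Poly_Mapping.lookup a i" and "q = Poly_Mapping.lookup a j"
    define a0 where "a0 = Poly_Mapping.update i 0 (Poly_Mapping.update j 0 a)"
    have pow: "X l ^ m = monom_x (Poly_Mapping.single l m)" for l m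
      by (induction m) (simp_all add: X_def monom_x_def mult_single flip: single_add)
    have a: "a = a0 + (Poly_Mapping.single i p + Poly_Mapping.single j q)"
      using False by (intro poly_mapping_eqI)
        (auto simp: a0_def p_def q_def lookup_add lookup_update lookup_single when_def)
    have a': "permute_expo ?s a = a0 + (Poly_Mapping.single j p + Poly_Mapping.single i q)"
      using False by (intro poly_mapping_eqI)
        (auto simp: a0_def p_def q_def lookup_permute_expo lookup_add lookup_update lookup_single
          when_def transpose_def)
    have "Poly_Mapping.single a b - Poly_Mapping.single (permute_expo ?s a) b
        = Poly_Mapping.single a0 b * (X i ^ p * X j ^ q - X j ^ p * X i ^ q)"
      unfolding a' by (subst a) (simp add: pow monom_x_def mult_single right_diff_distrib)
    also have "X i ^ p * X j ^ q - X j ^ p * X i ^ q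
        = X j ^ q * (X i ^ p - X j ^ p) - X j ^ p * (X i ^ q - X j ^ q)"
      by (simp add: algebra_simps)
    finally have eq: "Poly_Mapping.single a b - Poly_Mapping.single (permute_expo ?s a) b
        = Poly_Mapping.single a0 b * (X j ^ q * (X i ^ p - X j ^ p) - X j ^ p * (X i ^ q - X j ^ q))" .
    have dvd: "X i - X j dvd X i ^ m - X j ^ m" for m
      unfolding power_diff_sumr2 by (rule dvd_triv_left)
    then show ?thesis unfolding eq by (intro dvd_mult dvd_diff[OF dvd_mult dvd_mult] dvd)
  qed
  moreover have "Poly_Mapping.update a b f - K i j (Poly_Mapping.update a b f) =
     (f - K i j f) + (Poly_Mapping.single a b - Poly_Mapping.single (permute_expo ?s a) b)"
    by (simp add: upd K_add K_single)
  ultimately show ?case using update(3) by simp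
qed

lemma divided_difference:
  assumes "i \<noteq> j"
  shows "(X i - X j) * div_diff i j f = f - K i j f"
  unfolding div_diff_def
proof (rule theI')
  have "Poly_Mapping.single i (1::nat) \<noteq> Poly_Mapping.single j 1"
    using assms by (metis lookup_single_eq lookup_single_not_eq zero_neq_one)
  then have "X i \<noteq> X j"
    by (auto simp: X_def monom_x_def dest!: arg_cong[of _ _ "\<lambda>f. Poly_Mapping.lookup f (Poly_Mapping.single i 1)"]
        simp: lookup_single when_def)
  moreover obtain g where "f - K i j f = (X i - X j) * g"
    using X_diff_dvd by (rule dvdE)
  ultimately show "\<exists>!g. (X i - X j) * g = f - K i j f"
    by (intro ex1I[of _ g]) auto
qed

end

theory Submission
  imports Defs
begin

text \<open>
  The operator \<open>S n u\<close> preserves polynomials whose coefficients are regular at \<open>b\<close>, and it is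
  triangular on orbit sums with respect to dominance, with the eigenvalues of the Jack polynomials
  on the diagonal. If \<open>P lam\<close> has a pole at \<open>b\<close>, multiply it by the power of \<open>beta - b\<close> that just
  clears all poles and specialize to \<open>beta = b\<close>: the result is a nonzero eigenvector in which \<open>lam\<close>
  no longer occurs, so comparing coefficients at a dominance-maximal \<open>mu\<close> shows that the eigenvalues
  of \<open>mu\<close> and \<open>lam\<close> agree at \<open>b\<close> for all \<open>u\<close>. Hence some permutation \<open>w\<close> satisfies
  \<open>(k + 1) (mu i - lam (w i)) = (w i - i) (r - 1)\<close>, and admissibility of \<open>lam\<close> together with
  monotonicity of \<open>mu\<close> forces \<open>w = id\<close>.
\<close>

section \<open>Shifted partitions with equal multisets\<close>

text \<open>
  Coprimality makes every displacement \<open>w i - i\<close> a multiple of \<open>k + 1\<close>. If \<open>w\<close> is not the identity,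
  there are neighbours \<open>p\<close> and \<open>p + 1\<close> with \<open>w p = p + (k + 1) t\<close> for some \<open>t > 0\<close> and
  \<open>w (p + 1) = p + 1 - (k + 1) s\<close> for some \<open>s \<ge> 0\<close>. Then \<open>w p - w (p + 1) \<ge> k (t + s)\<close>, so admissibility
  yields a drop of at least \<open>r (t + s)\<close>, whereas \<open>m (p + 1) \<le> m p\<close> allows only \<open>(r - 1) (t + s)\<close>.
\<close>

lemma permutes_shift_eq_id:
  fixes l m :: "nat \<Rightarrow> int"
  assumes k: "k \<ge> 1" and r: "r \<ge> 2" and cop: "coprime (k + 1) (r - 1)"
    and m: "\<And>i. 1 \<le> i \<Longrightarrow> Suc i \<le> n \<Longrightarrow> m (Suc i) \<le> m i"
    and l: "\<And>i j. 1 \<le> i \<Longrightarrow> i \<le> j \<Longrightarrow> j \<le> n \<Longrightarrow> l j \<le> l i"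
    and adm: "\<And>i. 1 \<le> i \<Longrightarrow> i + k \<le> n \<Longrightarrow> l i - l (i + k) \<ge> int r"
    and w: "w permutes {1..n}"
    and eq: "\<And>i. i \<in> {1..n} \<Longrightarrow> int (k + 1) * (m i - l (w i)) = (int (w i) - int i) * int (r - 1)"
  shows "w = id"
proof (rule ccontr)
  assume "w \<noteq> id"
  \<comment> \<open>A permutation of naturals that moves no point up is the identity.\<close>
  then obtain i where i: "i \<in> {1..n}" "w i > i"
    using permutes_natset_le[OF w] by (metis not_le)
  have wn: "w j \<in> {1..n}" if "j \<in> {1..n}" for j
    using permutes_in_image[OF w] that by blast
  have "w n \<le> n" using wn[of n] i by auto
  moreover have "i < n" using i wn[of i] by auto
  ultimately have ex: "i < n \<and> w n \<le> n" by simp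
  \<comment> \<open>\<open>j\<close> is the first point after \<open>i\<close> that is not moved up;
    \<open>n\<close> shows that one exists. Minimality forces its predecessor \<open>p\<close> to
    move up.\<close>
  define j where "j = (LEAST j. i < j \<and> w j \<le> j)"
  have j: "i < j" "w j \<le> j" and jn: "j \<le> n"
    using LeastI[of "\<lambda>j. i < j \<and> w j \<le> j", OF ex] Least_le[of "\<lambda>j. i < j \<and> w j \<le> j", OF ex]
    by (simp_all add: j_def)
  define p where "p = j - 1"
  have p: "j = Suc p" "i \<le> p" using j by (auto simp: p_def)
  have wp: "w p > p"
  proof (cases "p = i")
    case False
    then have "i < p" "p < j" using p by auto
    then show ?thesis using not_less_Least[of p "\<lambda>j. i < j \<and> w j \<le> j"] by (auto simp: j_def)
  qed (use i in simp)
  \<comment> \<open>Admissibility is applied \<open>q\<close> times in steps of \<open>k\<close>;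
    monotonicity covers the rest of the way to \<open>b\<close>.\<close>
  have gap: "l a - l b \<ge> int r * int q" if "1 \<le> a" "a + k * q \<le> b" "b \<le> n" for a b q
    using that
  proof (induction q arbitrary: a)
    case 0
    then show ?case using l[of a b] by simp
  next
    case (Suc q)
    have "l (a + k) - l b \<ge> int r * int q" using Suc.prems by (intro Suc.IH) auto
    moreover have "l a - l (a + k) \<ge> int r" using Suc.prems by (intro adm) auto
    ultimately show ?case by (simp add: algebra_simps)
  qed
  have dv: "int (k + 1) dvd int (w a) - int a" if "a \<in> {1..n}" for a
  proof -
    have "coprime (int (k + 1)) (int (r - 1))" using cop coprime_int_iff by blast
    then show ?thesis using eq[OF that] by (metis coprime_dvd_mult_left_iff dvd_triv_left)
  qed
  have pj: "p \<in> {1..n}" "j \<in> {1..n}" using p i jn by auto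
  obtain t' where t': "int (w p) - int p = int (k + 1) * t'" using dv[OF pj(1)] by (rule dvdE)
  obtain s' where s': "int (w j) - int j = int (k + 1) * s'" using dv[OF pj(2)] by (rule dvdE)
  have "0 < int (k + 1) * t'" using wp t' by linarith
  then have t0: "t' > 0" by (simp add: zero_less_mult_iff)
  have "int (k + 1) * s' \<le> 0" using j(2) s' by linarith
  then have s0: "s' \<le> 0" by (simp add: mult_le_0_iff)
  define t s where "t = nat t'" and "s = nat (- s')"
  have t: "int (w p) = int p + int (k + 1) * int t" "t > 0" using t' t0 by (auto simp: t_def)
  have s: "int (w j) = int j - int (k + 1) * int s" using s' s0 by (auto simp: s_def)
  have "int (k + 1) * (m p - l (w p)) = int (k + 1) * (int t * int (r - 1))"
    using eq[OF pj(1)] t by simp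
  then have mp: "m p = l (w p) + int t * int (r - 1)"
    by (simp only: mult_cancel_left) linarith
  have "int (k + 1) * (m j - l (w j)) = int (k + 1) * (- int s * int (r - 1))"
    using eq[OF pj(2)] s by simp
  then have mj: "m j = l (w j) - int s * int (r - 1)"
    by (simp only: mult_cancel_left) linarith
  \<comment> \<open>Here \<open>w p - w j = (k + 1) (t + s) - 1\<close>; the loss of 1 is absorbed
    because \<open>t + s > 0\<close>.\<close>
  have "int (w j + k * (t + s)) \<le> int (w p)"
    using t s p(1) by (simp add: algebra_simps)
  then have "w j + k * (t + s) \<le> w p" by linarith
  then have "l (w j) - l (w p) \<ge> int r * int (t + s)"
    using wn[OF pj(1)] wn[OF pj(2)] by (intro gap) auto
  moreover have "m j \<le> m p" using m[of p] p pj by auto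
  ultimately have "int r * int (t + s) \<le> int (r - 1) * int (t + s)"
    using mp mj by (simp add: algebra_simps)
  then show False using t(2) r by simp
qed

text \<open>Agreement at all complex \<open>u\<close> makes the products equal as polynomials in
  \<open>u\<close>, so the multisets of their roots \<open>- f i\<close> and \<open>- g i\<close>
  coincide; \<open>w\<close> matches these roots.\<close>

lemma permutes_of_prod_shift_eq:
  fixes f g :: "'i \<Rightarrow> complex"
  assumes "finite A" and "\<And>u. (\<Prod>i\<in>A. u + f i) = (\<Prod>i\<in>A. u + g i)"
  obtains w where "w permutes A" and "\<And>i. i \<in> A \<Longrightarrow> f i = g (w i)"
proof -
  have "poly (\<Prod>i\<in>A. [:f i, 1:]) u = poly (\<Prod>i\<in>A. [:g i, 1:]) u" for u
    using assms(2)[of u] by (simp add: poly_prod add.commute)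
  then have "(\<Prod>i\<in>A. [:f i, 1:]) = (\<Prod>i\<in>A. [:g i, 1:])"
    by (intro poly_eq_poly_eq_iff[THEN iffD1] ext)
  then have "proots (\<Prod>i\<in>A. [:f i, 1:]) = proots (\<Prod>i\<in>A. [:g i, 1:])" by simp
  moreover have "proots (\<Prod>i\<in>A. [:h i, 1:]) = image_mset (\<lambda>i. - h i) (mset_set A)"
    for h :: "'i \<Rightarrow> complex"
    using assms(1) by (induction A rule: finite_induct) (simp_all add: proots_mult del: mult_pCons_left)
  ultimately have "image_mset (\<lambda>i. - f i) (mset_set A) = image_mset (\<lambda>i. - g i) (mset_set A)"
    by simp
  then obtain w where "w permutes A" "\<forall>i\<in>A. - f i = - g (w i)"
    using image_mset_eq_implies_permutes[OF assms(1)] by blast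
  then show thesis by (intro that) auto
qed

section \<open>Linearity of the operators\<close>

text \<open>A monomial factor shifts exponents. The form \<open>s + a\<close> avoids truncated
  subtraction; all other exponents fall under \<open>lookup_single_mult_eq_0\<close>.\<close>

lemma lookup_single_mult:
  fixes f :: mpol
  shows "Poly_Mapping.lookup (Poly_Mapping.single s c * f) (s + a) = c * Poly_Mapping.lookup f a"
proof (induction f rule: update_induct)
  case const
  then show ?case by simp
next
  case (update f b d)
  have "Poly_Mapping.update b d f = f + Poly_Mapping.single b d"
    using update(1) by (intro poly_mapping_eqI)
      (auto simp: lookup_update lookup_add lookup_single when_def in_keys_iff)
  then show ?case using update(3)
    by (simp add: distrib_left lookup_add mult_single lookup_single when_def)
qed

lemma lookup_single_mult_eq_0:
  fixes f :: mpol
  assumes "\<And>b. a \<noteq> s + b"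
  shows "Poly_Mapping.lookup (Poly_Mapping.single s c * f) a = 0"
proof (induction f rule: update_induct)
  case const
  then show ?case by simp
next
  case (update f b d)
  have "Poly_Mapping.update b d f = f + Poly_Mapping.single b d"
    using update(1) by (intro poly_mapping_eqI)
      (auto simp: lookup_update lookup_add lookup_single when_def in_keys_iff)
  then show ?case using update(3) assms[of b]
    by (simp add: distrib_left lookup_add mult_single lookup_single when_def)
qed

lemma lookup_scale: "Poly_Mapping.lookup (scale c f) a = c * Poly_Mapping.lookup f a"
  using lookup_single_mult[of 0 c f a] by (simp add: scale_def)

lemma lookup_X_mult:
  "Poly_Mapping.lookup (X i * f) (Poly_Mapping.single i 1 + a) = Poly_Mapping.lookup f a"
  by (simp add: X_def monom_x_def lookup_single_mult)

lemma lookup_X_mult_eq_0: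
  "Poly_Mapping.lookup a i = 0 \<Longrightarrow> Poly_Mapping.lookup (X i * f) a = 0"
  unfolding X_def monom_x_def
  by (rule lookup_single_mult_eq_0) (auto simp: lookup_add)

lemma expo_eq_single_add:
  fixes a :: expo
  assumes "Poly_Mapping.lookup a i \<noteq> 0"
  shows "a = Poly_Mapping.single i 1 + (a - Poly_Mapping.single i 1)"
  using assms by (intro poly_mapping_eqI) (auto simp: lookup_add lookup_minus lookup_single when_def)

lemma lookup_partial:
  "Poly_Mapping.lookup (partial i f) a =
    of_nat (Poly_Mapping.lookup a i + 1) * Poly_Mapping.lookup f (Poly_Mapping.single i 1 + a)"
proof -
  let ?e = "Poly_Mapping.single i (1::nat)"
  \<comment> \<open>If \<open>b\<close> has exponent 0 at \<open>i\<close>, then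
    \<open>b - ?e\<close> is just \<open>b\<close> and may equal \<open>a\<close>, but the
    coefficient vanishes; otherwise \<open>b\<close> is recovered from
    \<open>b - ?e\<close>.\<close>
  have *: "Poly_Mapping.lookup (Poly_Mapping.single (b - ?e)
        (of_nat (Poly_Mapping.lookup b i) * Poly_Mapping.lookup f b)) a
      = (if b = ?e + a then of_nat (Poly_Mapping.lookup a i + 1) * Poly_Mapping.lookup f b else 0)" for b
  proof (cases "Poly_Mapping.lookup b i = 0")
    case True
    then have "b \<noteq> ?e + a" by (auto simp: lookup_add)
    then show ?thesis using True by simp
  next
    case False
    then have "b - ?e = a \<longleftrightarrow> b = ?e + a" using expo_eq_single_add[OF False] by (metis add_diff_cancel_left')
    then show ?thesis by (auto simp: lookup_single when_def lookup_add)
  qed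
  show ?thesis
    unfolding partial_def lookup_sum * by (simp add: in_keys_iff)
qed

lemma X_eq_iff: "X i = X j \<longleftrightarrow> i = j"
proof
  assume "X i = X j"
  then have "Poly_Mapping.lookup (X i) (Poly_Mapping.single i 1) = Poly_Mapping.lookup (X j) (Poly_Mapping.single i 1)"
    by simp
  then have "Poly_Mapping.single j (1::nat) = Poly_Mapping.single i 1"
    by (simp add: X_def monom_x_def lookup_single when_def split: if_splits)
  then show "i = j" by (metis lookup_single_eq lookup_single_not_eq zero_neq_one)
qed simp

lemma module_hom_scaleI:
  assumes "\<And>f g. T (f + g) = T f + T g" and "\<And>c f. T (scale c f) = scale c (T f)"
  shows "module_hom scale scale T"
  by unfold_locales (simp_all add: assms)

lemma linear_K: "module_hom scale scale (K i j)"
  by (intro module_hom_scaleI poly_mapping_eqI)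
    (simp_all add: K_def lookup_permute_vars lookup_add lookup_scale)

lemma linear_partial: "module_hom scale scale (partial i)"
  by (intro module_hom_scaleI poly_mapping_eqI)
    (simp_all add: lookup_partial lookup_add lookup_scale algebra_simps)

lemma scale_mult_right: "f * scale c g = scale c (f * g)"
  by (simp add: scale_def mult.left_commute)

text \<open>The quotient is known only through its defining equation, so both identities are
  multiplied by \<open>X i - X j\<close>, reduced to linearity of \<open>K\<close>, and the nonzero
  factor is cancelled.\<close>

lemma linear_div_diff:
  assumes "i \<noteq> j"
  shows "module_hom scale scale (div_diff i j)"
proof (rule module_hom_scaleI)
  have nz: "X i - X j \<noteq> 0" using assms X_eq_iff by simp
  interpret K: module_hom scale scale "K i j" by (rule linear_K)
  show "div_diff i j (f + g) = div_diff i j f + div_diff i j g" for f g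
  proof -
    have "(X i - X j) * div_diff i j (f + g) = (X i - X j) * (div_diff i j f + div_diff i j g)"
      unfolding distrib_left divided_difference[OF assms] by (simp add: K.add)
    then show ?thesis using nz by (simp only: mult_cancel_left) simp
  qed
  show "div_diff i j (scale c f) = scale c (div_diff i j f)" for c f
  proof -
    have "(X i - X j) * div_diff i j (scale c f) = (X i - X j) * scale c (div_diff i j f)"
      unfolding scale_mult_right divided_difference[OF assms]
      by (simp add: K.scale mpol.scale_right_diff_distrib)
    then show ?thesis using nz by (simp only: mult_cancel_left) simp
  qed
qed

lemma linear_D: "module_hom scale scale (D n i)"
proof (rule module_hom_scaleI)
  interpret P: module_hom scale scale "partial i" by (rule linear_partial)
  show "D n i (f + g) = D n i f + D n i g" for f g
  proof -
    have "(\<Sum>j\<in>{1..n} - {i}. X (max i j) * div_diff i j (f + g)) =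
        (\<Sum>j\<in>{1..n} - {i}. X (max i j) * div_diff i j f) + (\<Sum>j\<in>{1..n} - {i}. X (max i j) * div_diff i j g)"
      unfolding sum.distrib[symmetric]
      by (intro sum.cong refl) (auto simp: module_hom.add[OF linear_div_diff] distrib_left)
    then show ?thesis
      unfolding D_def by (simp add: P.add mpol.scale_right_distrib distrib_left)
  qed
  show "D n i (scale c f) = scale c (D n i f)" for c f
  proof -
    have "(\<Sum>j\<in>{1..n} - {i}. X (max i j) * div_diff i j (scale c f)) =
        scale c (\<Sum>j\<in>{1..n} - {i}. X (max i j) * div_diff i j f)"
      unfolding mpol.scale_sum_right
      by (intro sum.cong refl) (auto simp: module_hom.scale[OF linear_div_diff] scale_mult_right)
    then show ?thesis
      unfolding D_def by (simp add: P.scale mpol.scale_right_distrib scale_mult_right mult.commute mult.left_commute)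
  qed
qed

lemma linear_S: "module_hom scale scale (S n u)"
proof -
  have "module_hom scale scale (\<lambda>f. foldr (\<lambda>i g. scale u g + D n i g) xs f)" for xs
  proof (induction xs)
    case Nil
    show ?case by (intro module_hom_scaleI) simp_all
  next
    case (Cons i xs)
    interpret M: module_hom scale scale "\<lambda>f. foldr (\<lambda>i g. scale u g + D n i g) xs f" by (rule Cons)
    interpret D: module_hom scale scale "D n i" by (rule linear_D)
    show ?case
      by (intro module_hom_scaleI)
        (simp_all add: M.add M.scale D.add D.scale mpol.scale_right_distrib mult.commute)
  qed
  then show ?thesis unfolding S_def[abs_def] .
qed

section \<open>Regularity at a point\<close>

text \<open>Specialization at \<open>b\<close> is a homomorphism defined only on functions regular
  at \<open>b\<close>, hence a relation instead of a total function.\<close>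

definition evaluates_to :: "ratfun \<Rightarrow> complex \<Rightarrow> complex \<Rightarrow> bool"
  where "evaluates_to f b z \<longleftrightarrow> (\<exists>p q. f = Fract p q \<and> poly q b \<noteq> 0 \<and> poly p b = z * poly q b)"

lemma not_has_pole_at_iff: "\<not> has_pole_at f b \<longleftrightarrow> (\<exists>z. evaluates_to f b z)"
proof
  assume "\<not> has_pole_at f b"
  then obtain p q where "f = Fract p q" "poly q b \<noteq> 0" by (auto simp: has_pole_at_def)
  then have "evaluates_to f b (poly p b / poly q b)"
    unfolding evaluates_to_def by (intro exI[of _ p] exI[of _ q]) simp
  then show "\<exists>z. evaluates_to f b z" by blast
qed (auto simp: has_pole_at_def evaluates_to_def)

lemma evaluates_to_unique: "evaluates_to f b z \<Longrightarrow> evaluates_to f b z' \<Longrightarrow> z = z'"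
proof -
  assume "evaluates_to f b z" "evaluates_to f b z'"
  then obtain p q p' q' where 1: "f = Fract p q" "poly q b \<noteq> 0" "poly p b = z * poly q b"
    and 2: "f = Fract p' q'" "poly q' b \<noteq> 0" "poly p' b = z' * poly q' b"
    unfolding evaluates_to_def by blast
  have "q \<noteq> 0" "q' \<noteq> 0" using 1 2 by auto
  then have "p * q' = p' * q" using 1 2 by (simp add: eq_fract)
  then have "poly p b * poly q' b = poly p' b * poly q b" by (metis poly_mult)
  then show "z = z'" using 1 2 by (simp add: mult.assoc mult.commute)
qed

lemma evaluates_to_Fract: "poly q b \<noteq> 0 \<Longrightarrow> poly p b = z * poly q b \<Longrightarrow> evaluates_to (Fract p q) b z"
  unfolding evaluates_to_def by blast

lemma evaluates_to_const: "evaluates_to (Fract [:z:] 1) b z"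
  by (rule evaluates_to_Fract) simp_all

lemma evaluates_to_beta: "evaluates_to beta b b"
  unfolding beta_def by (rule evaluates_to_Fract) simp_all

lemma evaluates_to_of_nat: "evaluates_to (of_nat m) b (of_nat m)"
  unfolding of_nat_fract by (rule evaluates_to_Fract) simp_all

lemma evaluates_to_0: "evaluates_to 0 b 0"
  using evaluates_to_of_nat[of 0 b] by simp

lemma evaluates_to_1: "evaluates_to 1 b 1"
  using evaluates_to_of_nat[of 1 b] by simp

lemma evaluates_to_add:
  assumes "evaluates_to f b y" and "evaluates_to g b z"
  shows "evaluates_to (f + g) b (y + z)"
proof -
  from assms obtain p q p' q' where 1: "f = Fract p q" "poly q b \<noteq> 0" "poly p b = y * poly q b"
    and 2: "g = Fract p' q'" "poly q' b \<noteq> 0" "poly p' b = z * poly q' b"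
    unfolding evaluates_to_def by blast
  have "q \<noteq> 0" "q' \<noteq> 0" using 1 2 by auto
  then have "f + g = Fract (p * q' + p' * q) (q * q')" using 1 2 by simp
  then show ?thesis using 1 2 by (auto intro!: evaluates_to_Fract simp: algebra_simps)
qed

lemma evaluates_to_mult:
  assumes "evaluates_to f b y" and "evaluates_to g b z"
  shows "evaluates_to (f * g) b (y * z)"
proof -
  from assms obtain p q p' q' where 1: "f = Fract p q" "poly q b \<noteq> 0" "poly p b = y * poly q b"
    and 2: "g = Fract p' q'" "poly q' b \<noteq> 0" "poly p' b = z * poly q' b"
    unfolding evaluates_to_def by blast
  then show ?thesis by (auto intro!: evaluates_to_Fract)
qed

lemma evaluates_to_sum:
  assumes "\<And>i. i \<in> A \<Longrightarrow> evaluates_to (f i) b (z i)"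
  shows "evaluates_to (\<Sum>i\<in>A. f i) b (\<Sum>i\<in>A. z i)"
  using assms
  by (induction A rule: infinite_finite_induct) (auto intro: evaluates_to_0 evaluates_to_add)

lemma evaluates_to_prod:
  assumes "\<And>i. i \<in> A \<Longrightarrow> evaluates_to (f i) b (z i)"
  shows "evaluates_to (\<Prod>i\<in>A. f i) b (\<Prod>i\<in>A. z i)"
  using assms
  by (induction A rule: infinite_finite_induct) (auto intro: evaluates_to_1 evaluates_to_mult)

abbreviation (input) regular :: "complex \<Rightarrow> ratfun \<Rightarrow> bool"
  where "regular b f \<equiv> \<not> has_pole_at f b"

lemma regularI: "evaluates_to f b z \<Longrightarrow> regular b f"
  using not_has_pole_at_iff by blast

lemma regular_0: "regular b 0"
  by (rule regularI, rule evaluates_to_0)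

lemma regular_of_nat: "regular b (of_nat m)"
  by (rule regularI, rule evaluates_to_of_nat)

lemma regular_beta: "regular b beta"
  by (rule regularI, rule evaluates_to_beta)

lemma regular_add: "regular b f \<Longrightarrow> regular b g \<Longrightarrow> regular b (f + g)"
  unfolding not_has_pole_at_iff using evaluates_to_add by blast

lemma regular_mult: "regular b f \<Longrightarrow> regular b g \<Longrightarrow> regular b (f * g)"
  unfolding not_has_pole_at_iff using evaluates_to_mult by blast

lemma regular_diff:
  assumes "regular b f" and "regular b g"
  shows "regular b (f - g)"
proof -
  have "regular b (Fract [:-1:] 1)" by (rule regularI, rule evaluates_to_const)
  moreover have "f - g = f + Fract [:-1:] 1 * g"
    by (cases g) (simp add: uminus_add_conv_diff[symmetric] del: add_fract)
  ultimately show ?thesis using assms by (metis regular_add regular_mult)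
qed

lemma regular_sum: "(\<And>i. i \<in> A \<Longrightarrow> regular b (f i)) \<Longrightarrow> regular b (\<Sum>i\<in>A. f i)"
  by (induction A rule: infinite_finite_induct) (simp_all add: regular_0 regular_add)

section \<open>Pole orders measured by powers of \<open>beta - b\<close>\<close>

abbreviation (input) local_parameter :: "complex \<Rightarrow> ratfun"
  where "local_parameter b \<equiv> Fract [:- b, 1:] 1"

text \<open>The order of the zero of the denominator at \<open>b\<close> is a suitable
  \<open>d\<close>: the power cancels exactly that zero.\<close>

lemma local_parameter_power_mult_regular:
  "\<exists>d. regular b (local_parameter b ^ d * f)"
proof (cases f rule: Fract_cases_nonzero)
  case (Fract p q)
  obtain q' where q': "q = [:- b, 1:] ^ order b q * q'" "\<not> [:- b, 1:] dvd q'"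
    using order_decomp[OF Fract(2)] by blast
  have pow: "local_parameter b ^ d = Fract ([:- b, 1:] ^ d) 1" for d
    by (induction d) (simp_all add: One_fract_def)
  have "local_parameter b ^ order b q * f = Fract ([:- b, 1:] ^ order b q * p) ([:- b, 1:] ^ order b q * q')"
    by (subst Fract(1), subst q'(1)) (simp add: pow)
  also have "\<dots> = Fract p q'" by (rule mult_fract_cancel) simp
  finally show ?thesis using q'(2) unfolding has_pole_at_def poly_eq_0_iff_dvd by metis
next
  case 0
  then show ?thesis by (simp add: regular_0)
qed

text \<open>A numerator vanishing at \<open>b\<close> is divisible by \<open>[:- b, 1:]\<close>,
  which cancels against the local parameter.\<close>

lemma regular_of_local_parameter_mult:
  assumes "evaluates_to (local_parameter b * f) b 0"
  shows "regular b f"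
proof -
  from assms obtain p q where pq: "local_parameter b * f = Fract p q" "poly q b \<noteq> 0" "poly p b = 0"
    unfolding evaluates_to_def by auto
  obtain p' where "p = [:- b, 1:] * p'" using pq(3) unfolding poly_eq_0_iff_dvd by (rule dvdE)
  then have "local_parameter b * f = local_parameter b * Fract p' q" using pq by (simp only: mult_fract mult_1)
  moreover have "local_parameter b \<noteq> 0" by (simp add: Zero_fract_def eq_fract)
  ultimately have "f = Fract p' q" by (simp only: mult_cancel_left) blast
  then show ?thesis using pq(2) unfolding has_pole_at_def by blast
qed

lemma evaluates_to_local_parameter: "evaluates_to (local_parameter b) b 0"
  by (rule evaluates_to_Fract) simp_all

text \<open>\<open>g\<close> is the least power of the local parameter clearing all poles. A pole
  forces a positive exponent, so \<open>g\<close> vanishes at \<open>b\<close>; minimality keeps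
  some product from vanishing there.\<close>

lemma clear_poles:
  assumes "finite F" and "\<not> (\<forall>f\<in>F. regular b f)"
  obtains g where "evaluates_to g b 0" and "\<forall>f\<in>F. regular b (g * f)"
    and "\<exists>f\<in>F. \<not> evaluates_to (g * f) b 0"
proof -
  let ?t = "local_parameter b"
  define Q where "Q d \<longleftrightarrow> (\<forall>f\<in>F. regular b (?t ^ d * f))" for d
  have t: "regular b (?t ^ m)" for m
    by (induction m) (simp_all add: regular_mult regularI[OF evaluates_to_1] regularI[OF evaluates_to_local_parameter] del: mult_fract)
  have "\<exists>d. Q d"
    using assms(1) unfolding Q_def
  proof (induction F rule: finite_induct)
    case (insert f F)
    obtain d where d: "\<forall>f\<in>F. regular b (?t ^ d * f)" using insert by blast
    obtain d' where d': "regular b (?t ^ d' * f)" using local_parameter_power_mult_regular by blast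
    have "regular b (?t ^ (d + d') * h)" if "h \<in> insert f F" for h
    proof -
      have "?t ^ (d + d') * h = ?t ^ d' * (?t ^ d * h)" "?t ^ (d + d') * h = ?t ^ d * (?t ^ d' * h)"
        by (simp_all only: power_add mult.assoc mult.left_commute)
      then show ?thesis using that d d' t by (metis insertE regular_mult)
    qed
    then show ?case by blast
  qed simp
  then have Q: "Q (LEAST d. Q d)" by (rule LeastI_ex)
  obtain d where d: "(LEAST d. Q d) = Suc d"
    using Q assms(2) by (cases "LEAST d. Q d") (auto simp: Q_def)
  have "\<not> Q d" using not_less_Least[of d Q] d by simp
  then obtain f where f: "f \<in> F" "\<not> regular b (?t ^ d * f)" unfolding Q_def by blast
  have QS: "Q (Suc d)" using Q unfolding d .
  show thesis
  proof (rule that)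
    show "\<forall>f\<in>F. regular b (?t ^ Suc d * f)" using QS unfolding Q_def .
    obtain z where "evaluates_to (?t ^ d) b z" using t not_has_pole_at_iff by blast
    from evaluates_to_mult[OF evaluates_to_local_parameter this] show "evaluates_to (?t ^ Suc d) b 0" by simp
    \<comment> \<open>If this product vanished at \<open>b\<close>, one factor \<open>?t\<close>
      could be removed and \<open>?t ^ d * f\<close> would be regular.\<close>
    have "\<not> evaluates_to (?t ^ Suc d * f) b 0"
      using f(2) regular_of_local_parameter_mult[of b "?t ^ d * f"] by (auto simp: mult.assoc)
    then show "\<exists>f\<in>F. \<not> evaluates_to (?t ^ Suc d * f) b 0" using f(1) by blast
  qed
qed

section \<open>Invariance of coefficientwise regularity under the operators\<close>

definition regular_coeffs :: "complex \<Rightarrow> mpol \<Rightarrow> bool"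
  where "regular_coeffs b f \<longleftrightarrow> (\<forall>a. regular b (Poly_Mapping.lookup f a))"

lemma regular_coeffs_X_mult: "regular_coeffs b f \<Longrightarrow> regular_coeffs b (X i * f)"
  unfolding regular_coeffs_def
proof
  fix a assume f: "\<forall>a. regular b (Poly_Mapping.lookup f a)"
  show "regular b (Poly_Mapping.lookup (X i * f) a)"
  proof (cases "Poly_Mapping.lookup a i = 0")
    case True
    then show ?thesis by (simp add: lookup_X_mult_eq_0 regular_0)
  next
    case False
    show ?thesis using f by (subst expo_eq_single_add[OF False], subst lookup_X_mult) blast
  qed
qed

text \<open>
  The coefficient of \<open>(X i - X j) * g\<close> at \<open>x\<^sub>i x\<^sup>a\<close> expresses the coefficient of \<open>g\<close> at \<open>a\<close> through
  a coefficient with a smaller exponent of \<open>x\<^sub>j\<close>.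
\<close>

lemma regular_coeffs_cancel_X_diff:
  assumes "i \<noteq> j" and "regular_coeffs b ((X i - X j) * g)"
  shows "regular_coeffs b g"
  unfolding regular_coeffs_def
proof
  fix a
  show "regular b (Poly_Mapping.lookup g a)"
  proof (induction "Poly_Mapping.lookup a j" arbitrary: a)
    case 0
    have "Poly_Mapping.lookup (X j * g) (Poly_Mapping.single i 1 + a) = 0"
      using 0 assms(1) by (intro lookup_X_mult_eq_0) (simp add: lookup_add lookup_single when_def)
    then have "Poly_Mapping.lookup ((X i - X j) * g) (Poly_Mapping.single i 1 + a) = Poly_Mapping.lookup g a"
      by (simp only: left_diff_distrib lookup_minus lookup_X_mult diff_zero)
    then show ?case using assms(2) unfolding regular_coeffs_def by metis
  next
    case (Suc m)
    define a' where "a' = Poly_Mapping.single i 1 + (a - Poly_Mapping.single j 1)"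
    have a: "a = Poly_Mapping.single j 1 + (a - Poly_Mapping.single j 1)"
      using Suc(2) by (intro expo_eq_single_add) simp
    have "Poly_Mapping.single i 1 + a = Poly_Mapping.single j 1 + a'"
      unfolding a'_def by (subst a) (simp only: add.left_commute)
    then have "Poly_Mapping.lookup (X j * g) (Poly_Mapping.single i 1 + a) = Poly_Mapping.lookup g a'"
      by (simp only: lookup_X_mult)
    then have "Poly_Mapping.lookup g a =
        Poly_Mapping.lookup ((X i - X j) * g) (Poly_Mapping.single i 1 + a) + Poly_Mapping.lookup g a'"
      by (simp only: left_diff_distrib lookup_minus lookup_X_mult diff_add_cancel)
    moreover have "m = Poly_Mapping.lookup a' j"
      using Suc(2) assms(1) by (simp add: a'_def lookup_add lookup_minus lookup_single when_def)
    ultimately show ?case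
      using Suc(1) assms(2) unfolding regular_coeffs_def by (metis regular_add)
  qed
qed

text \<open>\<open>K\<close> only permutes coefficients, so the dividend is regular, and division by
  \<open>X i - X j\<close> introduces no denominators.\<close>

lemma regular_coeffs_div_diff:
  assumes "i \<noteq> j" and "regular_coeffs b f"
  shows "regular_coeffs b (div_diff i j f)"
proof (rule regular_coeffs_cancel_X_diff[OF assms(1)])
  show "regular_coeffs b ((X i - X j) * div_diff i j f)"
    unfolding divided_difference[OF assms(1)]
    using assms(2) by (simp add: regular_coeffs_def lookup_minus K_def lookup_permute_vars regular_diff)
qed

lemma regular_coeffs_scale: "regular b c \<Longrightarrow> regular_coeffs b f \<Longrightarrow> regular_coeffs b (scale c f)"
  by (simp add: regular_coeffs_def lookup_scale regular_mult)

lemma regular_coeffs_add: "regular_coeffs b f \<Longrightarrow> regular_coeffs b g \<Longrightarrow> regular_coeffs b (f + g)"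
  by (simp add: regular_coeffs_def lookup_add regular_add)

lemma regular_coeffs_sum:
  "(\<And>i. i \<in> A \<Longrightarrow> regular_coeffs b (f i)) \<Longrightarrow> regular_coeffs b (\<Sum>i\<in>A. f i)"
  by (simp add: regular_coeffs_def lookup_sum regular_sum)

lemma regular_coeffs_partial: "regular_coeffs b f \<Longrightarrow> regular_coeffs b (partial i f)"
  unfolding regular_coeffs_def lookup_partial by (intro allI regular_mult regular_of_nat) blast

lemma regular_coeffs_D: "regular_coeffs b f \<Longrightarrow> regular_coeffs b (D n i f)"
  unfolding D_def
  by (intro regular_coeffs_add regular_coeffs_X_mult regular_coeffs_partial regular_coeffs_scale
      regular_coeffs_sum regular_coeffs_div_diff regular_beta regular_mult regular_of_nat) auto

lemma regular_coeffs_S: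
  assumes "regular b u" and "regular_coeffs b f"
  shows "regular_coeffs b (S n u f)"
proof -
  have "regular_coeffs b (foldr (\<lambda>i g. scale u g + D n i g) xs f)" for xs
    using assms by (induction xs) (auto intro: regular_coeffs_add regular_coeffs_scale regular_coeffs_D)
  then show ?thesis unfolding S_def .
qed

section \<open>Orbit sums and dominance\<close>

lemma lookup_orbit_sum:
  "Poly_Mapping.lookup (orbit_sum n nu) a = (if \<exists>\<sigma>. \<sigma> permutes {1..n} \<and> a = permute_expo \<sigma> nu then 1 else 0)"
proof -
  let ?O = "{permute_expo \<sigma> nu | \<sigma>. \<sigma> permutes {1..n}}"
  have "?O = (\<lambda>\<sigma>. permute_expo \<sigma> nu) ` {\<sigma>. \<sigma> permutes {1..n}}" by auto
  then have "finite ?O" by (simp add: finite_permutations)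
  then have "Poly_Mapping.lookup (orbit_sum n nu) a = (if a \<in> ?O then 1 else 0)"
    unfolding orbit_sum_def lookup_sum monom_x_def lookup_single when_def by simp
  then show ?thesis by auto
qed

text \<open>A weakly decreasing sequence is determined by the multiset of its entries, which
  permuting the variables preserves.\<close>

lemma permute_partition_eq:
  assumes "nu \<in> partitions n" and "permute_expo \<sigma> nu \<in> partitions n" and "\<sigma> permutes {1..n}"
  shows "permute_expo \<sigma> nu = nu"
proof -
  let ?l = "Poly_Mapping.lookup :: expo \<Rightarrow> nat \<Rightarrow> nat"
  have perm: "?l (permute_expo \<sigma> nu) i = ?l nu (\<sigma> i)" for i
    using assms(3) by (simp add: lookup_permute_expo permutes_inj)
  have srt: "sorted (rev (map (?l a) [1..<n+1]))" if "a \<in> partitions n" for a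
    using that by (simp add: partitions_def sorted_rev_iff_nth_mono del: upt_Suc)
  have "?l (permute_expo \<sigma> nu) = ?l nu \<circ> \<sigma>" by (rule ext) (simp add: perm)
  then have "mset (map (?l (permute_expo \<sigma> nu)) [1..<n+1]) = image_mset (?l nu) (image_mset \<sigma> (mset_set {1..n}))"
    by (simp add: multiset.map_comp comp_def atLeastLessThanSuc_atLeastAtMost del: upt_Suc)
  also have "\<dots> = mset (map (?l nu) [1..<n+1])"
    using assms(3) by (simp add: permutes_image_mset atLeastLessThanSuc_atLeastAtMost del: upt_Suc)
  finally have "rev (map (?l (permute_expo \<sigma> nu)) [1..<n+1]) = rev (map (?l nu) [1..<n+1])"
    using srt[OF assms(1)] srt[OF assms(2)] by (metis properties_for_sort mset_rev)
  then have "?l (permute_expo \<sigma> nu) i = ?l nu i" if "i \<in> {1..n}" for i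
    using that by (auto simp del: upt_Suc)
  moreover have "?l (permute_expo \<sigma> nu) i = ?l nu i" if "i \<notin> {1..n}" for i
    using perm permutes_not_in[OF assms(3) that] by simp
  ultimately show ?thesis by (intro poly_mapping_eqI) blast
qed

text \<open>An orbit contains only one partition, so coordinates with respect to orbit sums can be
  read off as coefficients at partitions.\<close>

lemma lookup_orbit_sum_partition:
  assumes "mu \<in> partitions n" and "nu \<in> partitions n"
  shows "Poly_Mapping.lookup (orbit_sum n nu) mu = (if mu = nu then 1 else 0)"
proof -
  have "mu = permute_expo id mu" by (intro poly_mapping_eqI) (simp add: lookup_permute_expo)
  then have "(\<exists>\<sigma>. \<sigma> permutes {1..n} \<and> mu = permute_expo \<sigma> nu) \<longleftrightarrow> mu = nu"
    using permute_partition_eq assms permutes_id by metis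
  then show ?thesis by (simp add: lookup_orbit_sum)
qed

lemma regular_coeffs_orbit_sum: "regular_coeffs b (orbit_sum n nu)"
  by (simp add: regular_coeffs_def lookup_orbit_sum regular_0 regularI[OF evaluates_to_1])

lemma strictly_below_trans:
  assumes "mu \<in> strictly_below n nu" and "nu \<in> strictly_below n lam"
  shows "mu \<in> strictly_below n lam"
proof -
  let ?s = "\<lambda>a i. \<Sum>j = 1..i. Poly_Mapping.lookup (a :: expo) j"
  have le: "?s mu i \<le> ?s nu i" "?s nu i \<le> ?s lam i" if "i \<in> {1..n}" for i
    using assms that by (auto simp: strictly_below_def dominated_def)
  have dom: "dominated n mu lam"
    using assms le unfolding strictly_below_def dominated_def by (auto intro: le_trans)
  have "mu \<noteq> lam"
  proof
    assume "mu = lam"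
    \<comment> \<open>The partial sums of \<open>nu\<close> are squeezed between equal ones; their
      consecutive differences then give \<open>mu = nu\<close>.\<close>
    have s: "?s mu i = ?s nu i" if "i \<le> n" for i
      using le[of i] that \<open>mu = lam\<close> by (cases "i = 0") auto
    have "Poly_Mapping.lookup mu i = Poly_Mapping.lookup nu i" for i
    proof (cases "i \<in> {1..n}")
      case True
      then obtain i' where "i = Suc i'" by (cases i) auto
      then show ?thesis using s[of i] s[of i'] True by simp
    next
      case False
      then have "Poly_Mapping.lookup a i = 0" if "a \<in> partitions n" for a
        using that by (auto simp: partitions_def in_keys_iff)
      then show ?thesis using assms unfolding strictly_below_def by simp
    qed
    then have "mu = nu" by (intro poly_mapping_eqI)
    then show False using assms by (simp add: strictly_below_def)
  qed
  then show ?thesis using assms dom by (simp add: strictly_below_def)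
qed

text \<open>This cardinality is a rank for dominance: it drives the induction below and later the
  choice of a maximal partition.\<close>

lemma card_strictly_below_less:
  assumes "mu \<in> strictly_below n nu"
  shows "card (strictly_below n mu) < card (strictly_below n nu)"
proof (rule psubset_card_mono[OF finite_strictly_below])
  have "mu \<notin> strictly_below n mu" by (simp add: strictly_below_def)
  then show "strictly_below n mu \<subset> strictly_below n nu"
    using assms strictly_below_trans by blast
qed

abbreviation (input) eigenvalue :: "nat \<Rightarrow> ratfun \<Rightarrow> expo \<Rightarrow> ratfun"
  where "eigenvalue n u lam \<equiv>
    (\<Prod>i = 1..n. u + of_nat (Poly_Mapping.lookup lam i) + of_nat (n - i) * beta)"

text \<open>Triangularity is deduced from the Jack basis without computing with \<open>D\<close>:
  \<open>P nu\<close> is an eigenvector with leading term \<open>orbit_sum n nu\<close>, and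
  induction handles the lower terms.\<close>

lemma lookup_S_orbit_sum:
  assumes jack: "jack_polynomials n P c"
    and "nu \<in> partitions n" and mu: "mu \<in> partitions n" and "mu \<notin> strictly_below n nu"
  shows "Poly_Mapping.lookup (S n u (orbit_sum n nu)) mu = (if mu = nu then eigenvalue n u nu else 0)"
  using assms(2,4)
proof (induction "card (strictly_below n nu)" arbitrary: nu rule: less_induct)
  case less
  interpret S: module_hom scale scale "S n u" by (rule linear_S)
  have P: "S n u (P nu) = scale (eigenvalue n u nu) (P nu)"
    "P nu = orbit_sum n nu + (\<Sum>kappa \<in> strictly_below n nu. scale (c nu kappa) (orbit_sum n kappa))"
    using jack less(2) unfolding jack_polynomials_def by blast+
  \<comment> \<open>As \<open>mu\<close> is not strictly below \<open>nu\<close>, it neither equals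
    nor lies below any such \<open>kappa\<close>, so the lower terms contribute nothing at
    \<open>mu\<close>.\<close>
  have kappa: "kappa \<in> partitions n" "mu \<noteq> kappa" "mu \<notin> strictly_below n kappa" if "kappa \<in> strictly_below n nu" for kappa
    using that less(3) strictly_below_trans[of mu n kappa nu] by (auto simp: strictly_below_def)
  have "Poly_Mapping.lookup (S n u (orbit_sum n kappa)) mu = 0" if "kappa \<in> strictly_below n nu" for kappa
    using less(1)[OF card_strictly_below_less[OF that]] kappa[OF that] by simp
  then have 1: "Poly_Mapping.lookup (S n u (P nu)) mu = Poly_Mapping.lookup (S n u (orbit_sum n nu)) mu"
    unfolding P(2) by (simp add: S.add S.sum S.scale lookup_add lookup_sum lookup_scale)
  have 2: "Poly_Mapping.lookup (P nu) mu = (if mu = nu then 1 else 0)"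
    using kappa mu less(2) unfolding P(2)
    by (simp add: lookup_add lookup_sum lookup_scale lookup_orbit_sum_partition)
  show ?case unfolding 1[symmetric] P(1) lookup_scale 2 by simp
qed

section \<open>Poles force coinciding eigenvalues\<close>

lemma eigenvalue_collision:
  assumes jack: "jack_polynomials n P c" and lam: "lam \<in> partitions n"
    and pole: "\<exists>mu \<in> strictly_below n lam. has_pole_at (c lam mu) b"
  obtains mu where "mu \<in> strictly_below n lam"
    and "\<And>u. (\<Prod>i = 1..n. u + of_nat (Poly_Mapping.lookup mu i) + of_nat (n - i) * b) =
             (\<Prod>i = 1..n. u + of_nat (Poly_Mapping.lookup lam i) + of_nat (n - i) * b)"
proof -
  let ?B = "insert lam (strictly_below n lam)"
  let ?ev = "\<lambda>u nu. \<Prod>i = 1..n. u + of_nat (Poly_Mapping.lookup nu i) + of_nat (n - i) * b"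
  have finB: "finite ?B" by (simp add: finite_strictly_below)
  have partB: "nu \<in> partitions n" if "nu \<in> ?B" for nu
    using that lam by (auto simp: strictly_below_def)
  have notin: "lam \<notin> strictly_below n lam" by (simp add: strictly_below_def)
  \<comment> \<open>Including the leading coefficient 1 turns \<open>P lam\<close> into a single sum
    over \<open>?B\<close>.\<close>
  define c' where "c' nu = (if nu = lam then 1 else c lam nu)" for nu
  have P: "P lam = (\<Sum>nu \<in> ?B. scale (c' nu) (orbit_sum n nu))"
  proof -
    have "P lam = orbit_sum n lam + (\<Sum>nu \<in> strictly_below n lam. scale (c lam nu) (orbit_sum n nu))"
      using jack lam unfolding jack_polynomials_def by blast
    moreover have "(\<Sum>nu \<in> strictly_below n lam. scale (c' nu) (orbit_sum n nu)) =
        (\<Sum>nu \<in> strictly_below n lam. scale (c lam nu) (orbit_sum n nu))"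
      using notin by (intro sum.cong) (auto simp: c'_def)
    ultimately show ?thesis using notin finite_strictly_below by (simp add: c'_def)
  qed
  have "\<not> (\<forall>f \<in> c' ` ?B. regular b f)"
    using pole notin by (auto simp: c'_def)
  then obtain g where g0: "evaluates_to g b 0"
    and reg: "\<forall>f \<in> c' ` ?B. regular b (g * f)"
    and "\<exists>f \<in> c' ` ?B. \<not> evaluates_to (g * f) b 0"
    by (rule clear_poles[OF finite_imageI[OF finB]])
  then have ex: "\<exists>nu\<in>?B. \<not> evaluates_to (g * c' nu) b 0" by (simp only: bex_simps)
  \<comment> \<open>\<open>?A\<close> indexes the terms that survive specialization at
    \<open>b\<close> once poles are cleared. Taking \<open>mu\<close> of maximal rank in
    \<open>?A\<close> makes every term strictly above \<open>mu\<close> vanish at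
    \<open>b\<close>.\<close>
  let ?A = "{nu \<in> ?B. \<not> evaluates_to (g * c' nu) b 0}"
  obtain mu where mu: "mu \<in> ?A"
    and max: "\<And>nu. nu \<in> ?A \<Longrightarrow> card (strictly_below n nu) \<le> card (strictly_below n mu)"
  proof -
    let ?C = "(\<lambda>nu. card (strictly_below n nu)) ` ?A"
    have fin: "finite ?C" and "?C \<noteq> {}" using finB ex by auto
    then have "Max ?C \<in> ?C" by (rule Max_in)
    then obtain mu where mu: "Max ?C = card (strictly_below n mu)" "mu \<in> ?A" by (rule imageE)
    show thesis
    proof (rule that)
      show "card (strictly_below n nu) \<le> card (strictly_below n mu)" if "nu \<in> ?A" for nu
        using Max_ge[OF fin imageI[OF that]] by (simp only: mu(1))
    qed (rule mu(2))
  qed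
  have muB: "mu \<in> ?B" using mu by blast
  have mup: "mu \<in> partitions n" using muB by (rule partB)
  have ev0: "evaluates_to (g * c' nu) b 0" if "nu \<in> ?B" "mu \<in> strictly_below n nu" for nu
    using that max[of nu] card_strictly_below_less[OF that(2)] by fastforce
  obtain z where z: "evaluates_to (g * c' mu) b z" using bspec[OF reg imageI[OF muB]] not_has_pole_at_iff by blast
  have z0: "z \<noteq> 0" using z mu by auto
  have ev: "?ev u mu = ?ev u lam" for u
  proof -
    \<comment> \<open>\<open>S\<close> expects a rational function as parameter, so \<open>u\<close>
      enters as a constant.\<close>
    let ?u = "Fract [:u:] 1"
    interpret S: module_hom scale scale "S n ?u" by (rule linear_S)
    have eig: "evaluates_to (eigenvalue n ?u nu) b (?ev u nu)" for nu
      by (intro evaluates_to_prod evaluates_to_add evaluates_to_mult evaluates_to_const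
          evaluates_to_of_nat evaluates_to_beta)
    \<comment> \<open>The same coefficient at \<open>mu\<close> is computed twice: from the
      eigenvalue of \<open>P lam\<close> here, and termwise over orbit sums in
      \<open>rhs\<close>.\<close>
    have lhs: "g * Poly_Mapping.lookup (S n ?u (P lam)) mu = eigenvalue n ?u lam * (g * c' mu)"
    proof -
      have "S n ?u (P lam) = scale (eigenvalue n ?u lam) (P lam)"
        using jack lam unfolding jack_polynomials_def by blast
      moreover have "Poly_Mapping.lookup (P lam) mu = (\<Sum>nu\<in>?B. if mu = nu then c' nu else 0)"
        unfolding P lookup_sum lookup_scale
        by (intro sum.cong refl) (simp only: lookup_orbit_sum_partition[OF mup partB], simp)
      moreover have "\<dots> = c' mu" using finB muB by (simp only: sum.delta' if_True)
      ultimately show ?thesis by (simp add: lookup_scale)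
    qed
    have rhs: "g * Poly_Mapping.lookup (S n ?u (P lam)) mu =
        (\<Sum>nu\<in>?B. g * c' nu * Poly_Mapping.lookup (S n ?u (orbit_sum n nu)) mu)"
      unfolding P S.sum S.scale lookup_sum lookup_scale by (simp only: sum_distrib_left mult.assoc)
    \<comment> \<open>For \<open>nu\<close> above \<open>mu\<close>, a factor vanishing at
      \<open>b\<close> meets a regular one; for all other \<open>nu\<close>, triangularity leaves
      only \<open>nu = mu\<close>.\<close>
    have "evaluates_to (g * c' nu * Poly_Mapping.lookup (S n ?u (orbit_sum n nu)) mu) b
        (if mu = nu then z * ?ev u mu else 0)" if nu: "nu \<in> ?B" for nu
    proof (cases "mu \<in> strictly_below n nu")
      case True
      have "regular_coeffs b (S n ?u (orbit_sum n nu))"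
        by (intro regular_coeffs_S regular_coeffs_orbit_sum regularI[OF evaluates_to_const])
      then obtain y where "evaluates_to (Poly_Mapping.lookup (S n ?u (orbit_sum n nu)) mu) b y"
        unfolding regular_coeffs_def not_has_pole_at_iff by blast
      from evaluates_to_mult[OF ev0[OF nu True] this] show ?thesis
        using True by (auto simp: strictly_below_def)
    next
      case False
      then have "Poly_Mapping.lookup (S n ?u (orbit_sum n nu)) mu = (if mu = nu then eigenvalue n ?u nu else 0)"
        using lookup_S_orbit_sum[OF jack partB[OF nu] mup] by blast
      then show ?thesis using evaluates_to_mult[OF z eig] evaluates_to_0 by (cases "mu = nu") simp_all
    qed
    then have "evaluates_to (\<Sum>nu\<in>?B. g * c' nu * Poly_Mapping.lookup (S n ?u (orbit_sum n nu)) mu) b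
        (\<Sum>nu\<in>?B. if mu = nu then z * ?ev u mu else 0)"
      by (rule evaluates_to_sum)
    also have "(\<Sum>nu\<in>?B. if mu = nu then z * ?ev u mu else 0) = z * ?ev u mu"
      using finB muB by (simp only: sum.delta' if_True)
    finally have "evaluates_to (eigenvalue n ?u lam * (g * c' mu)) b (z * ?ev u mu)"
      using lhs rhs by simp
    from evaluates_to_unique[OF this evaluates_to_mult[OF eig z]] show ?thesis
      using z0 by simp
  qed
  \<comment> \<open>At \<open>lam\<close> the cleared coefficient is \<open>g\<close> itself, which
    vanishes at \<open>b\<close>.\<close>
  have "mu \<noteq> lam" using mu g0 by (auto simp: c'_def)
  then show thesis using that[of mu] muB ev by blast
qed

theorem lemma2p3:
  fixes k r n :: nat
    and P :: "expo \<Rightarrow> mpol"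
    and c :: "expo \<Rightarrow> expo \<Rightarrow> ratfun"
    and lam :: expo
  assumes "k \<ge> 1" and "r \<ge> 2" and "coprime (k + 1) (r - 1)" and "n \<ge> 1"
    and "jack_polynomials n P c"
    and "admissible k r n lam"
  shows "\<forall>mu \<in> strictly_below n lam. \<not> has_pole_at (c lam mu) (- ((of_nat r - 1) / (of_nat k + 1)))"
proof (rule ccontr)
  let ?b = "- ((of_nat r - 1) / (of_nat k + 1)) :: complex"
  let ?l = "Poly_Mapping.lookup :: expo \<Rightarrow> nat \<Rightarrow> nat"
  assume "\<not> ?thesis"
  then have pole: "\<exists>mu \<in> strictly_below n lam. has_pole_at (c lam mu) ?b" by blast
  have lam: "lam \<in> partitions n" using assms(6) by (simp add: admissible_def)
  obtain mu where mu: "mu \<in> strictly_below n lam"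
    and "\<And>u. (\<Prod>i = 1..n. u + of_nat (?l mu i) + of_nat (n - i) * ?b) =
             (\<Prod>i = 1..n. u + of_nat (?l lam i) + of_nat (n - i) * ?b)"
    using eigenvalue_collision[OF assms(5) lam pole] by blast
  \<comment> \<open>Isolating \<open>u\<close> in each factor lets the roots of the two products be
    matched by a permutation.\<close>
  then have "(\<Prod>i = 1..n. u + (of_nat (?l mu i) + of_nat (n - i) * ?b)) =
             (\<Prod>i = 1..n. u + (of_nat (?l lam i) + of_nat (n - i) * ?b))" for u
    by (simp only: add.assoc)
  then obtain w where w: "w permutes {1..n}"
    and eq: "\<And>i. i \<in> {1..n} \<Longrightarrow> of_nat (?l mu i) + of_nat (n - i) * ?b = of_nat (?l lam (w i)) + of_nat (n - w i) * ?b"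
    using permutes_of_prod_shift_eq[of "{1..n}"
        "\<lambda>i. of_nat (?l mu i) + of_nat (n - i) * ?b" "\<lambda>i. of_nat (?l lam i) + of_nat (n - i) * ?b"]
    by (metis (no_types, lifting) finite_atLeastAtMost)
  have mup: "mu \<in> partitions n" using mu by (simp add: strictly_below_def)
  have "int (k + 1) * (int (?l mu i) - int (?l lam (w i))) = (int (w i) - int i) * int (r - 1)"
    if i: "i \<in> {1..n}" for i
  proof -
    have wi: "w i \<in> {1..n}" using i permutes_in_image[OF w] by blast
    have k0: "(of_nat k + 1 :: complex) \<noteq> 0" using of_nat_neq_0[of k, where 'a = complex] by (simp add: add.commute)
    have "of_nat (?l mu i) - of_nat (?l lam (w i)) = (of_nat (n - w i) - of_nat (n - i)) * ?b"
      using eq[OF i] by (simp add: algebra_simps)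
    also have "of_nat (n - w i) - of_nat (n - i) = (of_nat i - of_nat (w i) :: complex)"
      using i wi by (simp add: of_nat_diff)
    \<comment> \<open>The factor \<open>k + 1\<close> clears the denominator of \<open>?b\<close>,
      whose sign reverses \<open>i - w i\<close>; all entries are then integers and the identity
      transfers to \<open>int\<close>.\<close>
    finally have "(of_nat k + 1) * (of_nat (?l mu i) - of_nat (?l lam (w i)))
        = (of_nat k + 1) * ((of_nat i - of_nat (w i)) * ?b)"
      by (simp only:)
    also have "\<dots> = (of_nat (w i) - of_nat i) * (of_nat r - 1)"
      using k0 by (simp add: divide_simps) (simp add: algebra_simps)
    finally have "(of_int (int (k + 1) * (int (?l mu i) - int (?l lam (w i)))) :: complex)
        = of_int ((int (w i) - int i) * int (r - 1))"
      using assms(2) by (simp add: of_nat_diff add.commute)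
    then show ?thesis by (simp only: of_int_eq_iff)
  qed
  moreover have "int (?l mu (Suc i)) \<le> int (?l mu i)" if "1 \<le> i" "Suc i \<le> n" for i
    using mup that by (simp add: partitions_def)
  moreover have "int (?l lam j) \<le> int (?l lam i)" if "1 \<le> i" "i \<le> j" "j \<le> n" for i j
    using lam that by (simp add: partitions_def)
  moreover have "int (?l lam i) - int (?l lam (i + k)) \<ge> int r" if "1 \<le> i" "i + k \<le> n" for i
    using assms(6) that by (simp add: admissible_def)
  ultimately have "w = id"
    using permutes_shift_eq_id[OF assms(1-3) _ _ _ w, of "\<lambda>i. int (?l mu i)" "\<lambda>i. int (?l lam i)"]
    by blast
  \<comment> \<open>With \<open>w = id\<close> the shifts by multiples of \<open>?b\<close>
    cancel.\<close>
  then have "?l mu i = ?l lam i" if "i \<in> {1..n}" for i using eq[OF that] by simp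
  moreover have "?l mu i = ?l lam i" if "i \<notin> {1..n}" for i
  proof -
    have "?l a i = 0" if "a \<in> partitions n" for a
      using that \<open>i \<notin> {1..n}\<close> unfolding partitions_def by (auto simp: in_keys_iff)
    then show ?thesis using lam mup by simp
  qed
  ultimately have "mu = lam" by (intro poly_mapping_eqI) blast
  then show False using mu by (simp add: strictly_below_def)
qed

end
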